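(* Let $u\in W^{1,1}(\mathbb{S}^1)$ be a function with $u>0$ on $\mathbb{S}^1$ and $\|u\|_{L^1(\mathbb{S}^1)}=1$. Then the following two inequalities hold: $$\int_{\mathbb{S}^1}\arctan\left(\frac{\partial_x u}{u}\right)\partial_x u\,dx\ \geq\ \arctan\left(\|u\|_{\dot W^{1,1}(\mathbb{S}^1)}\right)\|u\|_{\dot W^{1,1}(\mathbb{S}^1)},$$ $$\int_{\mathbb{S}^1}\arctan\left(\frac{|\partial_x u|}{u}\right)\frac{|\partial_x u|}{u}\,dx\ \geq\ \frac{1}{4\pi}\arctan\left(\frac{\|u\|_{\dot W^{1,1}(\mathbb{S}^1)}^2}{\|\,|\partial_x u|\,u\|_{L^1(\mathbb{S}^1)}}\right)\frac{\|u\|_{\dot W^{1,1}(\mathbb{S}^1)}^2}{\|\,|\partial_x u|\,u\|_{L^1(\mathbb{S}^1)}}.$$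
   Context: $\mathbb{S}^1$ is the one-dimensional torus of length $2\pi$, identified with $[-\pi,\pi]$ with periodic boundary conditions and Lebesgue measure. $\|u\|_{\dot W^{1,1}(\mathbb{S}^1)}=\int_{\mathbb{S}^1}|\partial_x u|\,dx$. Functions in $W^{1,1}(\mathbb{S}^1)$ are identified with their continuous representatives. If $u$ is constant, the quotient $\|u\|_{\dot W^{1,1}}^2/\|\,|\partial_x u|\,u\|_{L^1}$ (formally $0/0$) is interpreted as $0$. *)

theory Defs
  imports "HOL-Analysis.Analysis"
begin

text \<open>
  Functions on the one-dimensional torus of length \<open>2\<pi>\<close> are represented by
  \<open>2\<pi>\<close>-periodic functions on the real line, and integrals over the torus are
  Lebesgue integrals over the fundamental domain \<open>[-\<pi>, \<pi>]\<close>.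
\<close>

definition circle_periodic :: "(real \<Rightarrow> real) \<Rightarrow> bool" where
  "circle_periodic f \<longleftrightarrow> (\<forall>x. f (x + 2 * pi) = f x)"

definition circle_integral :: "(real \<Rightarrow> real) \<Rightarrow> real" where
  "circle_integral f = (LINT x:{-pi..pi}|lebesgue. f x)"

definition circle_L1 :: "(real \<Rightarrow> real) set" where
  "circle_L1 = {f. circle_periodic f \<and> set_integrable lebesgue {-pi..pi} f}"

definition circle_L1_norm :: "(real \<Rightarrow> real) \<Rightarrow> real" where
  "circle_L1_norm f = circle_integral (\<lambda>x. \<bar>f x\<bar>)"

definition circle_test_functions :: "(real \<Rightarrow> real) set" where
  "circle_test_functions =
     {\<phi>. circle_periodic \<phi> \<and> (\<forall>k x. (deriv ^^ k) \<phi> field_differentiable (at x))}"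

text \<open>
  Weak derivatives are determined only up to null sets, so being one is a relation.
  There is no boundary term, because the test functions are periodic.
\<close>

definition has_circle_weak_deriv :: "(real \<Rightarrow> real) \<Rightarrow> (real \<Rightarrow> real) \<Rightarrow> bool" where
  "has_circle_weak_deriv u v \<longleftrightarrow>
     u \<in> circle_L1 \<and> v \<in> circle_L1 \<and>
     (\<forall>\<phi>\<in>circle_test_functions.
        circle_integral (\<lambda>x. u x * deriv \<phi> x) = - circle_integral (\<lambda>x. v x * \<phi> x))"

definition circle_W11 :: "(real \<Rightarrow> real) set" where
  "circle_W11 = {u \<in> circle_L1. \<exists>v. has_circle_weak_deriv u v}"

text \<open>
  If \<open>u\<close> has the weak derivative \<open>v\<close>, its homogeneous seminorm is \<open>circle_L1_norm v\<close>.
  It does not depend on the representative \<open>v\<close>. The quotient of its square by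
  \<open>circle_L1_norm (\<lambda>x. \<bar>v x\<bar> * u x)\<close>, for continuous \<open>u > 0\<close>, has a vanishing
  denominator only if \<open>u\<close> is constant; it is then \<open>0 / 0 = 0\<close>, as wanted.
\<close>

end

theory Submission
  imports Defs
begin

text \<open>
  Both inequalities are convexity inequalities for \<open>g t = t * arctan t\<close>. Put \<open>w = \<bar>u'\<bar>\<close> and \<open>W = \<integral> w\<close>.

  Since arctan is odd, the first integrand equals \<open>u * g (w / u)\<close>. As \<open>u dx\<close> is a probability
  measure, Jensen's inequality bounds its integral below by \<open>g (\<integral> (w / u) * u) = g W\<close>.

  For the second inequality put \<open>B = \<integral> w / u\<close>, which is finite because the continuous function
  \<open>u > 0\<close> is bounded away from zero on the compact fundamental domain. Jensen's inequality for the uniform measure,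
  of total mass \<open>2 * pi\<close>, gives \<open>\<integral> g (w / u) \<ge> 2 * pi * g (B / (2 * pi)) = B * arctan (B / (2 * pi))\<close>.
  Concavity of arctan on the positive half-line yields \<open>arctan (B / (2 * pi)) \<ge> arctan B / (2 * pi)\<close>,
  so the integral is at least \<open>g B / (2 * pi) \<ge> g B / (4 * pi)\<close>. Finally
  \<open>W\<^sup>2 / (\<integral> w * u) \<le> B\<close> by the Cauchy--Schwarz inequality applied to
  \<open>w = sqrt (w / u) * sqrt (w * u)\<close>, and \<open>g\<close> is increasing on the positive half-line.

  Both uses of Jensen's inequality are instances of \<open>arctan_perspective_jensen\<close>, which works
  with an arbitrary positive density \<open>p\<close> in place of \<open>u\<close> and \<open>1\<close>.
\<close>

text \<open>The graph of the convex function \<open>t * arctan t\<close>, whose second derivative is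
  \<open>2 / (1 + t\<^sup>2)\<^sup>2\<close>, lies above each of its tangents.\<close>

lemma mult_arctan_above_tangent:
  fixes s t :: real
  shows "t * arctan t \<ge> s * arctan s + (arctan s + s / (1 + s\<^sup>2)) * (t - s)"
proof -
  have "(arctan s + s / (1 + s\<^sup>2)) * (t - s) \<le> t * arctan t - s * arctan s"
  proof (rule f''_imp_f'[where C = UNIV and f = "\<lambda>t. t * arctan t"
        and f'' = "\<lambda>t. 2 / (1 + t\<^sup>2)\<^sup>2"])
    fix x :: real
    have nz: "1 + x\<^sup>2 \<noteq> 0"
      by (metis add_pos_nonneg less_irrefl zero_le_power2 zero_less_one)
    show "((\<lambda>t. t * arctan t) has_real_derivative arctan x + x / (1 + x\<^sup>2)) (at x)"
      by (auto intro!: derivative_eq_intros simp: field_simps)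
    show "((\<lambda>t. arctan t + t / (1 + t\<^sup>2)) has_real_derivative 2 / (1 + x\<^sup>2)\<^sup>2) (at x)"
      by (rule derivative_eq_intros refl nz)+
        (use nz in \<open>simp add: divide_simps, simp add: power2_eq_square algebra_simps\<close>)
  qed auto
  then show ?thesis by linarith
qed

text \<open>Concavity of arctan on the positive half-line, through the origin.\<close>

lemma arctan_le_scaled_arctan:
  fixes c x :: real
  assumes "c \<ge> 1" "x \<ge> 0"
  shows "arctan x \<le> c * arctan (x / c)"
proof -
  define h where "h = (\<lambda>x. c * arctan (x / c) - arctan x)"
  have "h 0 \<le> h x"
  proof (rule DERIV_nonneg_imp_nondecreasing[OF assms(2)])
    fix y :: real
    have "(h has_real_derivative c * (1 / c * inverse (1 + (y / c)\<^sup>2)) - inverse (1 + y\<^sup>2)) (at y)"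
      unfolding h_def using assms(1) by (auto intro!: derivative_eq_intros)
    then have "(h has_real_derivative 1 / (1 + (y / c)\<^sup>2) - 1 / (1 + y\<^sup>2)) (at y)"
      using assms(1) by (simp add: inverse_eq_divide)
    moreover have "1 / (1 + y\<^sup>2) \<le> 1 / (1 + (y / c)\<^sup>2)"
    proof (rule divide_left_mono)
      have "\<bar>y / c\<bar> \<le> \<bar>y\<bar>"
        using assms(1) by (simp add: abs_divide divide_le_eq mult_le_cancel_left1)
      then show "1 + (y / c)\<^sup>2 \<le> 1 + y\<^sup>2"
        by (simp only: abs_le_square_iff add_le_cancel_left)
      show "0 < (1 + y\<^sup>2) * (1 + (y / c)\<^sup>2)"
        by (intro mult_pos_pos add_pos_nonneg) auto
    qed auto
    ultimately show "\<exists>d. (h has_real_derivative d) (at y) \<and> 0 \<le> d"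
      by force
  qed
  then show ?thesis by (simp add: h_def)
qed

lemma integrable_arctan_mult:
  fixes f w :: "'a \<Rightarrow> real"
  assumes "f \<in> borel_measurable M" "integrable M w"
  shows "integrable M (\<lambda>x. arctan (f x) * w x)"
proof (rule Bochner_Integration.integrable_bound)
  show "integrable M (\<lambda>x. pi / 2 * w x)"
    using assms by simp
  have "\<bar>arctan (f x)\<bar> * \<bar>w x\<bar> \<le> pi / 2 * \<bar>w x\<bar>" for x
    using arctan_bounded[of "f x"] by (intro mult_right_mono) auto
  then show "AE x in M. norm (arctan (f x) * w x) \<le> norm (pi / 2 * w x)"
    by (intro AE_I2) (simp add: abs_mult)
qed (use assms in measurable)

text \<open>Jensen's inequality for \<open>g t = t * arctan t\<close> and the measure of density \<open>p\<close>: the integrand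
  on the right is \<open>p * g (w / p)\<close>, which dominates the tangent of \<open>g\<close> at the mean slope
  \<open>s = (\<integral> w) / (\<integral> p)\<close>, multiplied by \<open>p\<close>. The linear term of the tangent integrates to zero.\<close>

lemma arctan_perspective_jensen:
  fixes p w :: "'a \<Rightarrow> real"
  assumes p: "integrable M p" and w: "integrable M w"
    and pos: "\<And>x. x \<in> space M \<Longrightarrow> p x > 0"
    and mass: "integral\<^sup>L M p > 0"
  shows "arctan (integral\<^sup>L M w / integral\<^sup>L M p) * integral\<^sup>L M w
           \<le> (\<integral>x. arctan (w x / p x) * w x \<partial>M)"
proof -
  define s where "s = integral\<^sup>L M w / integral\<^sup>L M p"
  define k where "k = arctan s + s / (1 + s\<^sup>2)"
  have sP: "s * integral\<^sup>L M p = integral\<^sup>L M w"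
    using mass by (simp add: s_def)
  have "(\<integral>x. s * arctan s * p x + k * (w x - s * p x) \<partial>M)
          \<le> (\<integral>x. arctan (w x / p x) * w x \<partial>M)"
  proof (rule integral_mono)
    show "integrable M (\<lambda>x. arctan (w x / p x) * w x)"
      using p w by (intro integrable_arctan_mult) auto
    fix x assume "x \<in> space M"
    then have px: "p x > 0" by (rule pos)
    have "p x * (s * arctan s + k * (w x / p x - s)) \<le> p x * (w x / p x * arctan (w x / p x))"
      using mult_arctan_above_tangent[of s "w x / p x"] px
      by (intro mult_left_mono) (auto simp: k_def)
    then show "s * arctan s * p x + k * (w x - s * p x) \<le> arctan (w x / p x) * w x"
      using px by (simp add: algebra_simps)
  qed (use p w in simp)
  moreover have "(\<integral>x. s * arctan s * p x + k * (w x - s * p x) \<partial>M)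
                   = arctan s * (s * integral\<^sup>L M p)"
    using p w sP by simp
  ultimately show ?thesis
    by (simp only: sP) (simp only: s_def)
qed

text \<open>The Cauchy--Schwarz inequality for \<open>sqrt (w / u) * sqrt (w * u)\<close>: integrate
  \<open>w * (1 - s * u)\<^sup>2 / u \<ge> 0\<close> with the minimising \<open>s = (\<integral> w) / (\<integral> w * u)\<close>. If
  \<open>\<integral> w * u = 0\<close>, then \<open>s = 0\<close>.\<close>

lemma integral_sq_quotient_le:
  fixes u w :: "'a \<Rightarrow> real"
  assumes w: "integrable M w" and wu: "integrable M (\<lambda>x. w x * u x)"
    and wdu: "integrable M (\<lambda>x. w x / u x)"
    and pos: "\<And>x. x \<in> space M \<Longrightarrow> u x > 0" and nonneg: "\<And>x. x \<in> space M \<Longrightarrow> w x \<ge> 0"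
  shows "(integral\<^sup>L M w)\<^sup>2 / (\<integral>x. w x * u x \<partial>M) \<le> (\<integral>x. w x / u x \<partial>M)"
proof -
  define C where "C = (\<integral>x. w x * u x \<partial>M)"
  define s where "s = integral\<^sup>L M w / C"
  have "0 \<le> (\<integral>x. w x / u x - 2 * s * w x + s\<^sup>2 * (w x * u x) \<partial>M)"
  proof (rule integral_nonneg_AE, rule AE_I2)
    fix x assume x: "x \<in> space M"
    have "w x / u x - 2 * s * w x + s\<^sup>2 * (w x * u x) = w x * (1 - s * u x)\<^sup>2 / u x"
      using pos[OF x] by (simp add: field_simps power2_eq_square)
    then show "0 \<le> w x / u x - 2 * s * w x + s\<^sup>2 * (w x * u x)"
      using pos[OF x] nonneg[OF x] by simp
  qed
  also have "\<dots> = (\<integral>x. w x / u x \<partial>M) - 2 * s * integral\<^sup>L M w + s\<^sup>2 * C"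
    using w wu wdu by (simp add: C_def)
  also have "\<dots> = (\<integral>x. w x / u x \<partial>M) - (integral\<^sup>L M w)\<^sup>2 / C"
    by (cases "C = 0") (simp_all add: s_def power2_eq_square)
  finally show ?thesis by (simp add: C_def)
qed

lemma circle_integral_eq_lebesgue_on:
  "circle_integral f = integral\<^sup>L (lebesgue_on {-pi..pi}) f"
  unfolding circle_integral_def set_lebesgue_integral_def
  by (subst integral_restrict_space) auto

lemma circle_L1_imp_integrable:
  "f \<in> circle_L1 \<Longrightarrow> integrable (lebesgue_on {-pi..pi}) f"
  unfolding circle_L1_def set_integrable_def
  by (subst integrable_restrict_space) auto

theorem theorem1p1:
  fixes u u' :: "real \<Rightarrow> real"
  assumes "u \<in> circle_W11"
    and "has_circle_weak_deriv u u'"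
    and "continuous_on UNIV u"
    and "\<And>x. u x > 0"
    and "circle_L1_norm u = 1"
  shows "(circle_integral (\<lambda>x. arctan (u' x / u x) * u' x)
           \<ge> arctan (circle_L1_norm u') * circle_L1_norm u') \<and>
        (circle_integral (\<lambda>x. arctan (\<bar>u' x\<bar> / u x) * (\<bar>u' x\<bar> / u x))
           \<ge> 1 / (4 * pi)
               * arctan ((circle_L1_norm u')\<^sup>2 / circle_L1_norm (\<lambda>x. \<bar>u' x\<bar> * u x))
               * ((circle_L1_norm u')\<^sup>2 / circle_L1_norm (\<lambda>x. \<bar>u' x\<bar> * u x)))"
proof -
  define M where "M = lebesgue_on {-pi..pi}"
  define w where "w = (\<lambda>x. \<bar>u' x\<bar>)"
  define A where "A = (integral\<^sup>L M w)\<^sup>2 / (\<integral>x. w x * u x \<partial>M)"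
  define B where "B = (\<integral>x. w x / u x \<partial>M)"
  note pos = assms(4)
  have u: "integrable M u" and w: "integrable M w"
    using assms(2) unfolding has_circle_weak_deriv_def M_def w_def
    by (auto intro!: circle_L1_imp_integrable integrable_abs)
  have space: "space M = {-pi..pi}"
    by (simp add: M_def)
  have cont: "continuous_on {-pi..pi} u"
    using assms(3) continuous_on_subset by blast
  have w_nonneg: "w x \<ge> 0" for x
    by (simp add: w_def)
  have circ: "circle_integral f = integral\<^sup>L M f" for f
    by (simp add: circle_integral_eq_lebesgue_on M_def)
  have norm_w: "circle_L1_norm u' = integral\<^sup>L M w"
    by (simp add: circle_L1_norm_def circ w_def)
  have norm_wu: "circle_L1_norm (\<lambda>x. \<bar>u' x\<bar> * u x) = (\<integral>x. w x * u x \<partial>M)"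
    using pos by (simp add: circle_L1_norm_def circ w_def abs_mult abs_of_pos)
  have mass_u: "integral\<^sup>L M u = 1"
    using assms(5) pos by (simp add: circle_L1_norm_def circ abs_of_pos)

  have "circle_integral (\<lambda>x. arctan (u' x / u x) * u' x) = (\<integral>x. arctan (w x / u x) * w x \<partial>M)"
    unfolding circ w_def
    by (rule Bochner_Integration.integral_cong) (auto simp: abs_if arctan_minus)
  then have first: "arctan (circle_L1_norm u') * circle_L1_norm u'
      \<le> circle_integral (\<lambda>x. arctan (u' x / u x) * u' x)"
    using arctan_perspective_jensen[OF u w] pos mass_u by (simp add: norm_w)

  have ne: "{-pi..pi} \<noteq> {}"
    by simp
  obtain m where m: "\<And>x. x \<in> {-pi..pi} \<Longrightarrow> u m \<le> u x"
    using continuous_attains_inf[OF compact_Icc ne cont] by blast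
  obtain K where K: "\<And>x. x \<in> {-pi..pi} \<Longrightarrow> u x \<le> u K"
    using continuous_attains_sup[OF compact_Icc ne cont] by blast
  have meas: "u \<in> borel_measurable M" "w \<in> borel_measurable M"
    using u w by auto
  have wu: "integrable M (\<lambda>x. w x * u x)"
  proof (rule Bochner_Integration.integrable_bound)
    show "integrable M (\<lambda>x. w x * u K)"
      using w by simp
    show "AE x in M. norm (w x * u x) \<le> norm (w x * u K)"
      using K pos w_nonneg
      by (intro AE_I2) (simp add: space abs_mult abs_of_pos mult_left_mono)
  qed (use meas in measurable)
  have wdu: "integrable M (\<lambda>x. w x / u x)"
  proof (rule Bochner_Integration.integrable_bound)
    show "integrable M (\<lambda>x. w x / u m)"
      using w by simp
    show "AE x in M. norm (w x / u x) \<le> norm (w x / u m)"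
      using m pos w_nonneg
      by (intro AE_I2) (simp add: space abs_of_pos divide_left_mono)
  qed (use meas in measurable)

  have mass_1: "integral\<^sup>L M (\<lambda>x. 1) = 2 * pi"
    by (simp add: M_def measure_restrict_space)
  have one: "integrable M (\<lambda>x. 1 :: real)"
    by (simp add: M_def integrable_restrict_space)
  have jensen: "arctan (B / (2 * pi)) * B \<le> (\<integral>x. arctan (w x / u x) * (w x / u x) \<partial>M)"
    using arctan_perspective_jensen[OF one wdu] mass_1 by (simp add: B_def)
  have A: "0 \<le> A"
    using pos w_nonneg by (auto simp: A_def less_imp_le intro!: divide_nonneg_nonneg integral_nonneg_AE)
  have AB: "A \<le> B"
    unfolding A_def B_def using integral_sq_quotient_le[OF w wu wdu] pos w_nonneg by simp
  have "1 / (4 * pi) * arctan A * A \<le> 1 / (2 * pi) * (arctan A * A)"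
    using A by (simp add: field_simps)
  also have "\<dots> \<le> 1 / (2 * pi) * (arctan B * B)"
    using A AB by (intro mult_left_mono mult_mono) (auto simp: arctan_monotone')
  also have "\<dots> = arctan B / (2 * pi) * B"
    by simp
  also have "\<dots> \<le> arctan (B / (2 * pi)) * B"
    using arctan_le_scaled_arctan[of "2 * pi" B] A AB pi_gt3
    by (intro mult_right_mono) (auto simp: divide_le_eq mult.commute)
  also note jensen
  finally have second: "1 / (4 * pi) * arctan A * A
      \<le> circle_integral (\<lambda>x. arctan (\<bar>u' x\<bar> / u x) * (\<bar>u' x\<bar> / u x))"
    by (simp add: circ w_def)
  show ?thesis
    using first second by (simp only: norm_wu norm_w A_def)
qed

end
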